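(* Let $n\ge 1$ and $r>1$ be integers. Then $\mathrm{h}(n,r)$ equals the maximum, over all sequences $(b_1,\dots,b_n)$ of $n$ nonzero integers (repetitions allowed), of the number of $r$-term zero-sum subsequences, i.e. of the number of $r$-element index sets $I\subseteq\{1,\dots,n\}$ with $\sum_{i\in I} b_i=0$. The same holds with nonzero rational numbers in place of nonzero integers.
   Context: For a finite set $A$ of irrational real numbers and an integer $r>1$, let $\mathcal{H}(A,r)$ denote the set of $r$-element subsets $A'\subseteq A$ for which $\sum_{x\in A'} x\in \mathbb{Q}$. Define $\mathrm{h}(n,r):=\max_{A} |\mathcal{H}(A,r)|$, the maximum being over all sets $A$ of $n$ (distinct) irrational real numbers. *)

theory Defs
  imports "HOL-Analysis.Analysis"
begin

definition rational_sum_subsets :: "real set \<Rightarrow> nat \<Rightarrow> real set set" where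
  "rational_sum_subsets A r = {A'. A' \<subseteq> A \<and> card A' = r \<and> \<Sum>A' \<in> \<rat>}"

definition h :: "nat \<Rightarrow> nat \<Rightarrow> nat" where
  "h n r = Max {card (rational_sum_subsets A r) | A. finite A \<and> card A = n \<and> A \<inter> \<rat> = {}}"

definition zero_sum_index_sets :: "(nat \<Rightarrow> 'a::comm_monoid_add) \<Rightarrow> nat \<Rightarrow> nat \<Rightarrow> nat set set" where
  "zero_sum_index_sets b n r = {I. I \<subseteq> {1..n} \<and> card I = r \<and> (\<Sum>i\<in>I. b i) = 0}"

text \<open>
  \<^const>\<open>Max\<close> is only meaningful on finite nonempty sets. The following facts show that every
  maximum taken here and in the main theorem is over such a set, and hence is attained.
\<close>

lemma finite_rational_sum_counts:
  "finite {card (rational_sum_subsets A r) | A. finite A \<and> card A = n \<and> A \<inter> \<rat> = {}}"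
proof (rule finite_subset)
  have "card (rational_sum_subsets A r) \<le> 2 ^ card A" if "finite A" for A
  proof -
    have "card (rational_sum_subsets A r) \<le> card (Pow A)"
    proof (rule card_mono)
      show "finite (Pow A)"
        using that by (rule finite_Pow_iff[THEN iffD2])
      show "rational_sum_subsets A r \<subseteq> Pow A"
        unfolding rational_sum_subsets_def by blast
    qed
    also have "\<dots> = 2 ^ card A"
      using that by (rule card_Pow)
    finally show ?thesis .
  qed
  then show "{card (rational_sum_subsets A r) | A. finite A \<and> card A = n \<and> A \<inter> \<rat> = {}} \<subseteq> {..2 ^ n}"
    by blast
  show "finite {..2 ^ n :: nat}"
    by (rule finite_atMost)
qed

lemma rational_sum_counts_nonempty:
  "{card (rational_sum_subsets A r) | A. finite A \<and> card A = n \<and> A \<inter> \<rat> = {}} \<noteq> {}"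
proof -
  have "infinite (- \<rat> :: real set)"
  proof
    assume "finite (- \<rat> :: real set)"
    then have "countable (\<rat> \<union> - \<rat> :: real set)"
      using countable_rat countable_finite countable_Un by blast
    moreover have "\<rat> \<union> - \<rat> = (UNIV :: real set)"
      by (rule Compl_partition)
    ultimately show False
      using uncountable_UNIV_real by metis
  qed
  then obtain A :: "real set" where "finite A" "card A = n" "A \<subseteq> - \<rat>"
    using infinite_arbitrarily_large by blast
  moreover from this have "A \<inter> \<rat> = {}"
    by blast
  ultimately show ?thesis
    by blast
qed

lemma finite_zero_sum_counts:
  "finite {card (zero_sum_index_sets b n r) | b. P b}"
proof (rule finite_subset)
  have "card (zero_sum_index_sets b n r) \<le> card (Pow {1..n})" for b :: "nat \<Rightarrow> 'a"
  proof (rule card_mono)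
    show "finite (Pow {1..n})"
      by simp
    show "zero_sum_index_sets b n r \<subseteq> Pow {1..n}"
      unfolding zero_sum_index_sets_def by blast
  qed
  then show "{card (zero_sum_index_sets b n r) | b. P b} \<subseteq> {..card (Pow {1..n})}"
    by blast
  show "finite {..card (Pow {1..n})}"
    by (rule finite_atMost)
qed

lemma zero_sum_counts_nonempty:
  "{card (zero_sum_index_sets b n r) | b :: nat \<Rightarrow> 'a::{comm_monoid_add, zero_neq_one}.
      \<forall>i\<in>{1..n}. b i \<noteq> 0} \<noteq> {}"
proof -
  have "card (zero_sum_index_sets (\<lambda>_. 1 :: 'a) n r) \<in>
      {card (zero_sum_index_sets b n r) | b :: nat \<Rightarrow> 'a. \<forall>i\<in>{1..n}. b i \<noteq> 0}"
    by (rule CollectI, rule exI[of _ "\<lambda>_. 1"]) simp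
  then show ?thesis
    by (metis empty_iff)
qed

end

theory Submission
  imports Defs
begin

text \<open>
  Three comparisons close a cycle between the three maxima.

  From irrational reals to nonzero rationals: view \<open>\<real>\<close> as a vector space over \<open>\<rat>\<close>. A rational
  linear functional that kills \<open>1\<close> sends every rational sum to a zero sum, so it only remains to
  choose it nonzero on each of the \<open>n\<close> given irrationals. For one irrational \<open>a\<close> this is possible
  because \<open>1\<close> and \<open>a\<close> are linearly independent over \<open>\<rat>\<close>; for finitely many, a generic combination
  of such functionals works, since finitely many proper subspaces do not cover a vector space over
  an infinite field (\<open>functional_avoiding_finite_set\<close>,
  \<open>rational_sum_count_le_zero_sum_count\<close>).

  From nonzero rationals to nonzero integers: multiply by a common denominator
  (\<open>zero_sum_index_sets_integral\<close>).

  From nonzero integers \<open>b\<^sub>1, \<dots>, b\<^sub>n\<close> to irrational reals: fix an irrational \<open>\<alpha>\<close> and take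
  \<open>a\<^sub>i = b\<^sub>i \<alpha> + i\<close>. Each \<open>a\<^sub>i\<close> is irrational because \<open>b\<^sub>i \<noteq> 0\<close>, the rational shifts \<open>i\<close> keep
  the \<open>a\<^sub>i\<close> distinct even where the \<open>b\<^sub>i\<close> repeat, and a zero sum of the \<open>b\<^sub>i\<close> cancels \<open>\<alpha>\<close>
  (\<open>zero_sum_count_le_rational_sum_count\<close>).
\<close>

section \<open>Rational functionals on the reals\<close>

text \<open>
  The numbers \<open>1\<close> and \<open>a\<close> are linearly independent over \<open>\<rat>\<close>, so they extend to a Hamel basis, on
  which a functional may be prescribed freely.
\<close>

lemma functional_separating_irrational:
  fixes a :: real
  assumes "a \<notin> \<rat>"
  obtains f :: "real \<Rightarrow> rat" where "Modules.additive f" "\<forall>x\<in>\<rat>. f x = 0" "f a = 1"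
proof -
  interpret Q: vector_space_pair "\<lambda>q x. of_rat q * x :: real" "(*) :: rat \<Rightarrow> rat \<Rightarrow> rat"
    by unfold_locales (simp_all add: algebra_simps of_rat_add of_rat_mult)
  have "a \<notin> Q.vs1.span {1}"
    using assms by (auto simp: Q.vs1.span_singleton)
  moreover have "Q.vs1.independent {1}"
    by (simp add: Q.vs1.independent_insert)
  ultimately have "Q.vs1.independent {a, 1}"
    by (simp add: Q.vs1.independent_insert)
  then obtain f where f: "Vector_Spaces.linear (\<lambda>q x. of_rat q * x) (*) f"
    and f_basis: "\<forall>x\<in>{a, 1}. f x = (if x = a then 1 else 0 :: rat)"
    using Q.linear_independent_extend[of "{a, 1}" "\<lambda>x. if x = a then 1 else 0"] by blast
  interpret f: Vector_Spaces.linear "\<lambda>q x. of_rat q * x :: real" "(*)" f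
    by (rule f)
  have "f 1 = 0"
    using f_basis assms by auto
  have "f x = 0" if "x \<in> \<rat>" for x
  proof -
    from that obtain q where "x = of_rat q"
      by (rule Rats_cases)
    then show ?thesis
      using f.scale[of q 1] \<open>f 1 = 0\<close> by simp
  qed
  moreover have "Modules.additive f"
    by unfold_locales (rule f.add)
  ultimately show thesis
    using that f_basis by simp
qed

text \<open>
  Perturbing a functional that works for \<open>A\<close> by a multiple \<open>c \<cdot> g\<close> of one that is nonzero at the new
  point only spoils it for finitely many values of \<open>c\<close>.
\<close>

lemma functional_avoiding_finite_set:
  fixes A :: "real set"
  assumes "finite A" and "A \<inter> \<rat> = {}"
  shows "\<exists>f :: real \<Rightarrow> rat. Modules.additive f \<and> (\<forall>x\<in>\<rat>. f x = 0) \<and> (\<forall>a\<in>A. f a \<noteq> 0)"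
  using assms
proof (induction A rule: finite_induct)
  case empty
  have "Modules.additive (\<lambda>_ :: real. 0 :: rat)"
    by unfold_locales simp
  then show ?case
    by blast
next
  case (insert a A)
  then obtain f :: "real \<Rightarrow> rat"
    where f: "Modules.additive f" "\<forall>x\<in>\<rat>. f x = 0" "\<forall>x\<in>A. f x \<noteq> 0"
    by auto
  have "a \<notin> \<rat>"
    using insert.prems by blast
  then obtain g :: "real \<Rightarrow> rat"
    where g: "Modules.additive g" "\<forall>x\<in>\<rat>. g x = 0" "g a = 1"
    by (rule functional_separating_irrational)
  have "finite ((\<lambda>x. - f x / g x) ` insert a A)"
    using insert.hyps by blast
  then obtain c where c: "c \<notin> (\<lambda>x. - f x / g x) ` insert a A"
    using ex_new_if_finite[OF infinite_UNIV_char_0] by blast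
  have "f x + c * g x \<noteq> 0" if x: "x \<in> insert a A" for x
  proof (cases "g x = 0")
    case True
    then show ?thesis
      using x f(3) g(3) by auto
  next
    case False
    have "c \<noteq> - f x / g x"
      using c x by blast
    then show ?thesis
      using False by (auto simp: field_simps add_eq_0_iff)
  qed
  moreover have "Modules.additive (\<lambda>x. f x + c * g x)"
    by unfold_locales (simp add: Modules.additive.add[OF f(1)] Modules.additive.add[OF g(1)] algebra_simps)
  ultimately show ?case
    using f(2) g(2) by (intro exI[of _ "\<lambda>x. f x + c * g x"]) simp
qed

section \<open>Comparing the three counting problems\<close>

lemma rational_sum_count_le_zero_sum_count:
  fixes A :: "real set"
  assumes "finite A" and "card A = n" and "A \<inter> \<rat> = {}"
  obtains b :: "nat \<Rightarrow> rat" where "\<forall>i\<in>{1..n}. b i \<noteq> 0"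
    and "card (rational_sum_subsets A r) \<le> card (zero_sum_index_sets b n r)"
proof -
  obtain f :: "real \<Rightarrow> rat"
    where f: "Modules.additive f" "\<forall>x\<in>\<rat>. f x = 0" "\<forall>a\<in>A. f a \<noteq> 0"
    using functional_avoiding_finite_set[OF assms(1) assms(3)] by blast
  obtain a where a: "bij_betw a {1..n} A"
    using ex_bij_betw_nat_finite_1[OF assms(1)] assms(2) by blast
  have "rational_sum_subsets A r \<subseteq> (`) a ` zero_sum_index_sets (f \<circ> a) n r"
  proof
    fix A' assume "A' \<in> rational_sum_subsets A r"
    then have A': "A' \<subseteq> A" "card A' = r" "\<Sum>A' \<in> \<rat>"
      by (auto simp: rational_sum_subsets_def)
    then obtain I where I: "I \<subseteq> {1..n}" "A' = a ` I"
      using a by (metis bij_betw_imp_surj_on subset_imageE)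
    have inj: "inj_on a I"
      using a I(1) by (meson bij_betw_imp_inj_on inj_on_subset)
    have "(\<Sum>i\<in>I. (f \<circ> a) i) = sum f A'"
      using inj I(2) by (simp add: sum.reindex)
    also have "\<dots> = f (\<Sum>A')"
      by (simp add: Modules.additive.sum[OF f(1)])
    also have "\<dots> = 0"
      using A'(3) f(2) by blast
    finally have "I \<in> zero_sum_index_sets (f \<circ> a) n r"
      using I A'(2) inj by (simp add: zero_sum_index_sets_def card_image)
    then show "A' \<in> (`) a ` zero_sum_index_sets (f \<circ> a) n r"
      using I(2) by blast
  qed
  moreover have "finite (zero_sum_index_sets (f \<circ> a) n r)"
    by (rule finite_subset[of _ "Pow {1..n}"]) (auto simp: zero_sum_index_sets_def)
  ultimately have "card (rational_sum_subsets A r) \<le> card (zero_sum_index_sets (f \<circ> a) n r)"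
    by (rule surj_card_le[rotated])
  moreover have "\<forall>i\<in>{1..n}. (f \<circ> a) i \<noteq> 0"
    using f(3) bij_betwE[OF a] by simp
  ultimately show thesis
    using that by blast
qed

lemma common_denominator:
  fixes S :: "rat set"
  assumes "finite S"
  shows "\<exists>N :: int. N \<noteq> 0 \<and> (\<forall>q\<in>S. of_int N * q \<in> \<int>)"
  using assms
proof (induction S rule: finite_induct)
  case empty
  show ?case
    by (rule exI[of _ 1]) simp
next
  case (insert q S)
  then obtain N :: int where N: "N \<noteq> 0" "\<forall>x\<in>S. of_int N * x \<in> \<int>"
    by blast
  obtain k d :: int where q: "q = of_int k / of_int d" "d \<noteq> 0"
    by (cases q) (auto simp: Fract_of_int_quotient)
  have "of_int (N * d) * x \<in> \<int>" if x: "x \<in> insert q S" for x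
  proof (cases "x = q")
    case True
    then have "of_int (N * d) * x = of_int (N * k)"
      using q by simp
    then show ?thesis
      by (metis Ints_of_int)
  next
    case False
    then have "of_int N * x \<in> \<int>"
      using x N(2) by blast
    then have "of_int d * (of_int N * x) \<in> \<int>"
      by (rule Ints_mult[OF Ints_of_int])
    then show ?thesis
      by (simp add: algebra_simps)
  qed
  then show ?case
    using N(1) q(2) by (intro exI[of _ "N * d"]) simp
qed

lemma zero_sum_index_sets_integral:
  fixes b :: "nat \<Rightarrow> rat"
  assumes "\<forall>i\<in>{1..n}. b i \<noteq> 0"
  obtains c :: "nat \<Rightarrow> int" where "\<forall>i\<in>{1..n}. c i \<noteq> 0"
    and "zero_sum_index_sets c n r = zero_sum_index_sets b n r"
proof -
  obtain N :: int where N: "N \<noteq> 0" "\<forall>q\<in>b ` {1..n}. of_int N * q \<in> \<int>"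
    using common_denominator[of "b ` {1..n}"] by blast
  have "\<forall>i\<in>{1..n}. \<exists>z :: int. of_int N * b i = of_int z"
    using N(2) by (auto elim: Ints_cases)
  then obtain c :: "nat \<Rightarrow> int" where c: "\<And>i. i \<in> {1..n} \<Longrightarrow> of_int N * b i = of_int (c i)"
    by metis
  have "(\<Sum>i\<in>I. c i) = 0 \<longleftrightarrow> (\<Sum>i\<in>I. b i) = 0" if "I \<subseteq> {1..n}" for I
  proof -
    have "(of_int (\<Sum>i\<in>I. c i) :: rat) = (\<Sum>i\<in>I. of_int N * b i)"
      unfolding of_int_sum using that by (intro sum.cong refl c[symmetric]) auto
    then have "(of_int (\<Sum>i\<in>I. c i) :: rat) = of_int N * (\<Sum>i\<in>I. b i)"
      by (simp only: sum_distrib_left)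
    then show ?thesis
      using N(1) by (metis mult_eq_0_iff of_int_eq_0_iff)
  qed
  then have "zero_sum_index_sets c n r = zero_sum_index_sets b n r"
    unfolding zero_sum_index_sets_def by blast
  moreover have "\<forall>i\<in>{1..n}. c i \<noteq> 0"
    using c N(1) assms by (metis mult_eq_0_iff of_int_eq_0_iff)
  ultimately show thesis
    using that by blast
qed

lemma int_multiple_plus_nat_in_Rats_iff:
  fixes \<alpha> :: real and k :: int and m :: nat
  assumes "\<alpha> \<notin> \<rat>"
  shows "of_int k * \<alpha> + of_nat m \<in> \<rat> \<longleftrightarrow> k = 0"
proof
  assume "of_int k * \<alpha> + of_nat m \<in> \<rat>"
  then have "of_int k * \<alpha> \<in> \<rat>"
    using Rats_diff[of "of_int k * \<alpha> + of_nat m" "of_nat m"] by simp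
  then have "of_int k * \<alpha> / of_int k \<in> \<rat>"
    by (rule Rats_divide) simp
  then show "k = 0"
    using assms by (cases "k = 0") simp_all
qed simp

lemma zero_sum_count_le_rational_sum_count:
  fixes b :: "nat \<Rightarrow> int"
  assumes "\<forall>i\<in>{1..n}. b i \<noteq> 0"
  obtains A :: "real set" where "finite A" "card A = n" "A \<inter> \<rat> = {}"
    and "card (zero_sum_index_sets b n r) \<le> card (rational_sum_subsets A r)"
proof -
  obtain \<alpha> :: real where \<alpha>: "\<alpha> \<notin> \<rat>"
    using countable_rat uncountable_UNIV_real by (metis UNIV_eq_I)
  define a where "a i = of_int (b i) * \<alpha> + of_nat i" for i
  have inj: "inj a"
  proof (rule injI)
    fix i j assume eq: "a i = a j"
    then have "of_int (b i - b j) * \<alpha> + of_nat i = of_nat j"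
      by (simp add: a_def algebra_simps)
    then have "of_int (b i - b j) * \<alpha> + of_nat i \<in> \<rat>"
      by simp
    then have "b i = b j"
      using int_multiple_plus_nat_in_Rats_iff[OF \<alpha>, of "b i - b j" i] by simp
    then show "i = j"
      using eq by (simp add: a_def)
  qed
  define A where "A = a ` {1..n}"
  have "finite A" "card A = n"
    using inj by (auto simp: A_def card_image inj_on_subset)
  moreover have "A \<inter> \<rat> = {}"
    using assms by (auto simp: A_def a_def int_multiple_plus_nat_in_Rats_iff[OF \<alpha>])
  moreover have "card (zero_sum_index_sets b n r) \<le> card (rational_sum_subsets A r)"
  proof (rule card_inj_on_le)
    show "inj_on ((`) a) (zero_sum_index_sets b n r)"
      using inj by (simp add: inj_on_def inj_image_eq_iff)
    show "(`) a ` zero_sum_index_sets b n r \<subseteq> rational_sum_subsets A r"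
    proof (rule image_subsetI)
      fix I assume "I \<in> zero_sum_index_sets b n r"
      then have I: "I \<subseteq> {1..n}" "card I = r" "(\<Sum>i\<in>I. b i) = 0"
        by (auto simp: zero_sum_index_sets_def)
      have injI: "inj_on a I"
        using inj by (rule inj_on_subset) simp
      have "\<Sum>(a ` I) = sum a I"
        using injI by (simp add: sum.reindex)
      also have "\<dots> = of_int (\<Sum>i\<in>I. b i) * \<alpha> + of_nat (\<Sum>i\<in>I. i)"
        by (simp add: a_def sum.distrib sum_distrib_right)
      finally have "\<Sum>(a ` I) \<in> \<rat>"
        by (simp only: int_multiple_plus_nat_in_Rats_iff[OF \<alpha>] I(3))
      then show "a ` I \<in> rational_sum_subsets A r"
        using I injI by (auto simp: rational_sum_subsets_def A_def card_image)
    qed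
    show "finite (rational_sum_subsets A r)"
      using \<open>finite A\<close> by (auto simp: rational_sum_subsets_def)
  qed
  ultimately show thesis
    by (rule that)
qed

section \<open>Equality of the three maxima\<close>

theorem mainTheorem6:
  fixes n r :: nat
  assumes "n \<ge> 1" and "r > 1"
  shows "h n r = Max {card (zero_sum_index_sets b n r) | b :: nat \<Rightarrow> int. \<forall>i\<in>{1..n}. b i \<noteq> 0}
       \<and> h n r = Max {card (zero_sum_index_sets b n r) | b :: nat \<Rightarrow> rat. \<forall>i\<in>{1..n}. b i \<noteq> 0}"
proof -
  let ?R = "{card (rational_sum_subsets A r) | A. finite A \<and> card A = n \<and> A \<inter> \<rat> = {}}"
  let ?Z = "{card (zero_sum_index_sets b n r) | b :: nat \<Rightarrow> int. \<forall>i\<in>{1..n}. b i \<noteq> 0}"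
  let ?Q = "{card (zero_sum_index_sets b n r) | b :: nat \<Rightarrow> rat. \<forall>i\<in>{1..n}. b i \<noteq> 0}"
  have Max_le: "Max S \<le> Max T"
    if "finite S" "S \<noteq> {}" "finite T" "\<And>s. s \<in> S \<Longrightarrow> \<exists>t\<in>T. s \<le> t" for S T :: "nat set"
    using that by (meson Max_ge Max_in order_trans)
  have "Max ?R \<le> Max ?Q"
  proof (rule Max_le[OF finite_rational_sum_counts rational_sum_counts_nonempty
        finite_zero_sum_counts])
    fix s assume "s \<in> ?R"
    then obtain A where "finite A" "card A = n" "A \<inter> \<rat> = {}"
      and s: "s = card (rational_sum_subsets A r)"
      by blast
    then obtain b :: "nat \<Rightarrow> rat" where "\<forall>i\<in>{1..n}. b i \<noteq> 0"
      "card (rational_sum_subsets A r) \<le> card (zero_sum_index_sets b n r)"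
      by (metis rational_sum_count_le_zero_sum_count)
    then show "\<exists>t\<in>?Q. s \<le> t"
      using s by blast
  qed
  moreover have "Max ?Q \<le> Max ?Z"
  proof (rule Max_le[OF finite_zero_sum_counts zero_sum_counts_nonempty finite_zero_sum_counts])
    fix s assume "s \<in> ?Q"
    then obtain b :: "nat \<Rightarrow> rat" where "\<forall>i\<in>{1..n}. b i \<noteq> 0"
      and s: "s = card (zero_sum_index_sets b n r)"
      by blast
    then obtain c :: "nat \<Rightarrow> int" where "\<forall>i\<in>{1..n}. c i \<noteq> 0"
      "zero_sum_index_sets c n r = zero_sum_index_sets b n r"
      by (metis zero_sum_index_sets_integral)
    then have "s \<in> ?Z"
      using s by (intro CollectI exI[of _ c]) simp
    then show "\<exists>t\<in>?Z. s \<le> t"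
      by blast
  qed
  moreover have "Max ?Z \<le> Max ?R"
  proof (rule Max_le[OF finite_zero_sum_counts zero_sum_counts_nonempty
        finite_rational_sum_counts])
    fix s assume "s \<in> ?Z"
    then obtain b :: "nat \<Rightarrow> int" where "\<forall>i\<in>{1..n}. b i \<noteq> 0"
      and s: "s = card (zero_sum_index_sets b n r)"
      by blast
    then obtain A :: "real set" where "finite A" "card A = n" "A \<inter> \<rat> = {}"
      "card (zero_sum_index_sets b n r) \<le> card (rational_sum_subsets A r)"
      by (metis zero_sum_count_le_rational_sum_count)
    then show "\<exists>t\<in>?R. s \<le> t"
      using s by blast
  qed
  ultimately show ?thesis
    unfolding h_def by linarith
qed

end
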